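(* Let $\mu$ range over all Borel probability measures on $\mathbb{R}_+ = [0,\infty)$, and for each $\mu$ let $X_1, X_2, X_3, X_4$ be independent random variables with distribution $\mu$. Then $$0.400695 \;\le\; \sup_{\mu}\, \mathbb{P}_{\mu^{\otimes 4}}\left[X_1 + X_2 + X_3 < 2 X_4\right] \;\le\; \frac{673}{1615} \;\le\; 0.417 .$$
   Context: $\mu^{\otimes 4}$ denotes the 4-fold product measure on $\mathbb{R}_+^4$, and $X_1,\dots,X_4$ are the coordinate variables. *)

theory Defs
  imports "HOL-Probability.Probability"
begin

definition borel_prob_nonneg :: "real measure set" where
  "borel_prob_nonneg = {\<mu>. prob_space \<mu> \<and> sets \<mu> = sets (restrict_space borel {0..})}"

lemma space_borel_prob_nonneg: "\<mu> \<in> borel_prob_nonneg \<Longrightarrow> space \<mu> = {0..}"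
  using sets_eq_imp_space_eq[of \<mu> "restrict_space borel {0..}"]
  by (simp add: borel_prob_nonneg_def space_restrict_space)

definition product4 :: "real measure \<Rightarrow> (nat \<Rightarrow> real) measure" where
  "product4 \<mu> = (\<Pi>\<^sub>M i\<in>{1..4}. \<mu>)"

definition event_prob :: "real measure \<Rightarrow> real" where
  "event_prob \<mu> =
     measure (product4 \<mu>) {X \<in> space (product4 \<mu>). X 1 + X 2 + X 3 < 2 * X 4}"

(* Sup on the reals is only meaningful for nonempty sets that are bounded above, and
   measure is 0 on non-measurable sets; the next three lemmas exclude both degeneracies. *)

lemma event_measurable:
  assumes "\<mu> \<in> borel_prob_nonneg"
  shows "{X \<in> space (product4 \<mu>). X 1 + X 2 + X 3 < 2 * X 4} \<in> sets (product4 \<mu>)"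
proof -
  have s: "sets \<mu> = sets (restrict_space borel {0..})"
    using assms by (simp add: borel_prob_nonneg_def)
  have id: "(\<lambda>x. x) \<in> borel_measurable \<mu>"
    unfolding measurable_cong_sets[OF s refl]
    by (rule measurable_restrict_space1) simp
  have c: "(\<lambda>X. X i) \<in> borel_measurable (product4 \<mu>)" if "i \<in> {1..4}" for i :: nat
    using measurable_compose[OF measurable_component_singleton[OF that] id]
    by (simp add: product4_def)
  show ?thesis
    by (intro borel_measurable_less borel_measurable_add borel_measurable_times
        borel_measurable_const c) auto
qed

lemma borel_prob_nonneg_nonempty: "borel_prob_nonneg \<noteq> {}"
proof -
  have "prob_space (return (restrict_space borel {0..}) (0::real))"
    by (rule prob_space_return) (simp add: space_restrict_space)
  then have "return (restrict_space borel {0..}) (0::real) \<in> borel_prob_nonneg"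
    by (simp add: borel_prob_nonneg_def)
  then show ?thesis by blast
qed

lemma bdd_above_event_prob: "bdd_above (event_prob ` borel_prob_nonneg)"
proof (rule bdd_aboveI2)
  fix \<mu> assume "\<mu> \<in> borel_prob_nonneg"
  then have "prob_space (product4 \<mu>)"
    unfolding product4_def by (intro prob_space_PiM) (simp add: borel_prob_nonneg_def)
  then show "event_prob \<mu> \<le> 1"
    unfolding event_prob_def by (rule prob_space.prob_le_1)
qed

end

theory Submission
  imports Defs
begin

text \<open>
  Upper bound: sample \<open>N\<close> independent points and count, pointwise, the 4-tuples of distinct
  indices that satisfy the inequality.  Adding the points in increasing order, it suffices to bound
  the number of tuples that contain the current maximum \<open>M\<close>.  Let \<open>p\<close> of the \<open>n\<close> smaller points lie
  in \<open>[0, M/2]\<close> and \<open>m\<close> in \<open>(M/2, M]\<close>, and join \<open>b, c\<close> in the upper half when \<open>M + b < 2c\<close>.  The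
  maximum can occur on the small side with \<open>c\<close> winning only if \<open>c\<close> is in the upper half and at
  most one of the other two points is, and then these two are joined; whereas \<open>a + b + c < 2M\<close> with
  all three in the upper half forces an unjoined pair.  Optimising over the number of joined pairs
  and over \<open>m/n\<close> yields at most \<open>4 (sqrt 2 - 1) n^3\<close> tuples; the rational constant \<open>5/3\<close> is
  slightly larger than \<open>4 (sqrt 2 - 1)\<close> and leads to the bound \<open>5/12 < 673/1615\<close> as \<open>N\<close> grows.

  Lower bound: mix, with weight \<open>p\<close>, a tiny scaled copy of a good measure with, with weight
  \<open>1 - p\<close>, the uniform distribution on the points \<open>1 - 4^-1, \<dots>, 1 - 4^-K\<close>, for which
  \<open>X\<^sub>1 + X\<^sub>2 < 2 X\<^sub>3\<close> has probability close to \<open>2/3\<close>.  Iterating, and letting \<open>K\<close> grow, this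
  attains values arbitrarily close to \<open>p (2 - p) / ((1 + p) (1 + p\<^sup>2))\<close>, whose maximum \<open>0.40069537\<dots>\<close>
  is reached near \<open>p = 0.4743\<close>.
\<close>

section \<open>Counting in a sample\<close>

text \<open>The left side counts 4-tuples containing one extra point of maximal value
  \<open>M\<close>: the first set has it on the winning side, and the factor 3 accounts for its
  three places on the small side. In terms of the gaps \<open>u = M - x\<close>, the upper half is
  \<open>u < M/2\<close>, two points are joined when one gap exceeds twice the other, and
  \<open>x a + x b + x c < 2 * M\<close> says that the gaps sum to more than
  \<open>M\<close>.\<close>

lemma card_triples_with_max_le:
  fixes x :: "'i \<Rightarrow> real"
  assumes "finite B" "\<And>i. i \<in> B \<Longrightarrow> 0 \<le> x i" "\<And>i. i \<in> B \<Longrightarrow> x i \<le> M"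
  shows "real (card {(a, b, c) \<in> B \<times> B \<times> B. x a + x b + x c < 2 * M})
       + 3 * real (card {(a, b, c) \<in> B \<times> B \<times> B. x a + x b + M < 2 * x c})
       \<le> 5 / 3 * real (card B) ^ 3"
proof -
  define H where "H = {i \<in> B. M < 2 * x i}"
  define L where "L = B - H"
  define E where "E = {(a, b) \<in> H \<times> H. M + x a < 2 * x b}"
  \<comment> \<open>Ordered unjoined pairs; the diagonal belongs to \<open>NE\<close>, which covers
    triples with repeated indices.\<close>
  define NE where "NE = H \<times> H - (E \<union> E\<inverse>)"
  define TH where "TH = {(a, b, c) \<in> H \<times> H \<times> H. x a + x b + x c < 2 * M}"
  define T1 where "T1 = {(a, b, c) \<in> B \<times> B \<times> B. x a + x b + x c < 2 * M}"
  define T2 where "T2 = {(a, b, c) \<in> B \<times> B \<times> B. x a + x b + M < 2 * x c}"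
  define p where "p = real (card L)"
  define m where "m = real (card H)"
  define e where "e = real (card E)"
  define h where "h = real (card TH)"
  have HB: "H \<subseteq> B" and LB: "L \<subseteq> B" by (auto simp: H_def L_def)
  have fin [simp]: "finite H" "finite L" "finite B"
    using assms(1) by (auto simp: H_def L_def)
  have EH: "E \<subseteq> H \<times> H" by (auto simp: E_def)
  have finE [simp]: "finite E" using EH by (rule finite_subset) simp
  have "TH \<subseteq> H \<times> H \<times> H" by (auto simp: TH_def)
  then have finTH [simp]: "finite TH" by (rule finite_subset) simp
  have "card B = card L + card H"
    using card_Diff_subset[OF _ HB] card_mono[OF _ HB] by (simp add: L_def)
  then have cardB: "real (card B) = p + m" by (simp add: p_def m_def)
  have nn: "0 \<le> p" "0 \<le> m" "0 \<le> e" "0 \<le> h" by (auto simp: p_def m_def e_def h_def)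

  have cardNE: "real (card NE) = m\<^sup>2 - 2 * e"
  proof -
    \<comment> \<open>Adding \<open>M + x a < 2 * x b\<close> to its mirror image would give
      \<open>2 * M < x a + x b\<close>.\<close>
    have disj: "E \<inter> E\<inverse> = {}"
      using assms(3) HB by (force simp: E_def)
    have sub: "E \<union> E\<inverse> \<subseteq> H \<times> H" by (auto simp: E_def)
    have "card (E \<union> E\<inverse>) = 2 * card E"
      using disj by (subst card_Un_disjoint) auto
    moreover have "card NE = card (H \<times> H) - card (E \<union> E\<inverse>)"
      unfolding NE_def by (rule card_Diff_subset) (use sub in auto)
    moreover have "card (E \<union> E\<inverse>) \<le> card (H \<times> H)"
      by (rule card_mono) (use sub in auto)
    ultimately show ?thesis
      by (simp add: m_def e_def card_cartesian_product power2_eq_square of_nat_diff)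
  qed

  have hm: "h \<le> m ^ 3"
  proof -
    have "card TH \<le> card (H \<times> H \<times> H)"
      by (rule card_mono) (auto simp: TH_def)
    then have "card TH \<le> card H ^ 3"
      by (simp add: card_cartesian_product power3_eq_cube mult.assoc)
    then show ?thesis unfolding h_def m_def by (metis of_nat_le_iff of_nat_power)
  qed

  have hNE: "h \<le> 3 * m * (m\<^sup>2 - 2 * e)"
  proof -
    let ?U = "(\<lambda>((a, b), c). (a, b, c)) ` (NE \<times> H)"
    let ?V = "(\<lambda>((a, b), c). (a, c, b)) ` (NE \<times> H)"
    let ?W = "(\<lambda>((a, b), c). (c, a, b)) ` (NE \<times> H)"
    have finNE: "finite NE" by (auto simp: NE_def)
    \<comment> \<open>If all three pairs were joined, the gaps in decreasing order would be below
      \<open>M/2\<close>, \<open>M/4\<close> and \<open>M/8\<close>, so their sum would be below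
      \<open>M\<close>.\<close>
    have *: "(a, b) \<in> NE \<or> (a, c) \<in> NE \<or> (b, c) \<in> NE" if "(a, b, c) \<in> TH" for a b c
    proof (rule ccontr)
      assume "\<not> ?thesis"
      then have "M + x a < 2 * x b \<or> M + x b < 2 * x a"
        "M + x a < 2 * x c \<or> M + x c < 2 * x a"
        "M + x b < 2 * x c \<or> M + x c < 2 * x b"
        using that by (auto simp: NE_def TH_def E_def)
      moreover have "M < 2 * x a" "M < 2 * x b" "M < 2 * x c"
        "x a \<le> M" "x b \<le> M" "x c \<le> M" "x a + x b + x c < 2 * M"
        using that assms(3) by (auto simp: TH_def H_def)
      ultimately show False by linarith
    qed
    have "TH \<subseteq> ?U \<union> ?V \<union> ?W"
    proof
      fix t assume t: "t \<in> TH"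
      obtain a b c where abc: "t = (a, b, c)" by (cases t)
      from t abc have "a \<in> H" "b \<in> H" "c \<in> H" by (auto simp: TH_def)
      with *[of a b c] t abc show "t \<in> ?U \<union> ?V \<union> ?W"
        by (force simp: image_iff)
    qed
    then have "card TH \<le> card (?U \<union> ?V \<union> ?W)"
      by (rule card_mono[rotated]) (use finNE in auto)
    also have "\<dots> \<le> card ?U + card ?V + card ?W"
      by (meson add_le_mono card_Un_le le_refl le_trans)
    also have "\<dots> \<le> 3 * (card NE * card H)"
      using card_image_le[of "NE \<times> H" "\<lambda>((a, b), c). (a, b, c)"]
        card_image_le[of "NE \<times> H" "\<lambda>((a, b), c). (a, c, b)"]
        card_image_le[of "NE \<times> H" "\<lambda>((a, b), c). (c, a, b)"] finNE
      by (simp add: card_cartesian_product)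
    finally have "h \<le> 3 * (real (card NE) * m)"
      unfolding h_def m_def by (metis of_nat_le_iff of_nat_mult of_nat_numeral)
    then show ?thesis by (simp add: cardNE mult_ac)
  qed

  have T2: "real (card T2) \<le> p\<^sup>2 * m + 2 * p * e"
  proof -
    let ?V = "(\<lambda>(l, a, b). (l, a, b)) ` (L \<times> E)"
    let ?W = "(\<lambda>(l, a, b). (a, l, b)) ` (L \<times> E)"
    have "T2 \<subseteq> L \<times> L \<times> H \<union> ?V \<union> ?W"
    proof
      fix t assume t: "t \<in> T2"
      obtain a b c where abc: "t = (a, b, c)" by (cases t)
      from t abc have B: "a \<in> B" "b \<in> B" "c \<in> B" and ev: "x a + x b + M < 2 * x c"
        by (auto simp: T2_def)
      have "c \<in> H"
        using ev assms(2)[OF B(1)] assms(2)[OF B(2)] B by (auto simp: H_def)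
      \<comment> \<open>Two upper-half points would give \<open>x a + x b > M\<close>, hence
        \<open>x c > M\<close>.\<close>
      moreover have "a \<notin> H \<or> b \<notin> H"
        using ev assms(3)[OF B(3)] by (auto simp: H_def)
      moreover have "M + x b < 2 * x c" "M + x a < 2 * x c"
        using ev assms(2)[OF B(1)] assms(2)[OF B(2)] by auto
      ultimately show "t \<in> L \<times> L \<times> H \<union> ?V \<union> ?W"
        using B abc by (force simp: image_iff E_def L_def)
    qed
    then have "card T2 \<le> card (L \<times> L \<times> H \<union> ?V \<union> ?W)"
      by (rule card_mono[rotated]) auto
    also have "\<dots> \<le> card (L \<times> L \<times> H) + card ?V + card ?W"
      by (meson add_le_mono card_Un_le le_refl le_trans)
    also have "\<dots> \<le> card L * (card L * card H) + 2 * (card L * card E)"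
      using card_image_le[of "L \<times> E" "\<lambda>(l, a, b). (l, a, b)"]
        card_image_le[of "L \<times> E" "\<lambda>(l, a, b). (a, l, b)"]
      by (simp add: card_cartesian_product)
    finally have "real (card T2) \<le> real (card L * (card L * card H) + 2 * (card L * card E))"
      by (rule of_nat_mono)
    then show ?thesis by (simp add: p_def m_def e_def power2_eq_square mult_ac)
  qed

  have T1: "real (card T1) \<le> (p + m) ^ 3 - m ^ 3 + h"
  proof -
    have sub: "H \<times> H \<times> H \<subseteq> B \<times> B \<times> B" using HB by auto
    have "T1 \<subseteq> (B \<times> B \<times> B - H \<times> H \<times> H) \<union> TH"
      by (auto simp: T1_def TH_def)
    then have "card T1 \<le> card ((B \<times> B \<times> B - H \<times> H \<times> H) \<union> TH)"
      by (rule card_mono[rotated]) simp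
    also have "\<dots> \<le> card (B \<times> B \<times> B - H \<times> H \<times> H) + card TH" by (rule card_Un_le)
    also have "card (B \<times> B \<times> B - H \<times> H \<times> H) = card (B \<times> B \<times> B) - card (H \<times> H \<times> H)"
      by (rule card_Diff_subset) (use sub in auto)
    finally have "real (card T1) \<le> real (card (B \<times> B \<times> B) - card (H \<times> H \<times> H)) + h"
      unfolding h_def by (metis of_nat_add of_nat_le_iff)
    also have "card (H \<times> H \<times> H) \<le> card (B \<times> B \<times> B)"
      by (rule card_mono) (use sub in auto)
    then have "real (card (B \<times> B \<times> B) - card (H \<times> H \<times> H)) = real (card B) ^ 3 - m ^ 3"
      by (simp add: of_nat_diff card_cartesian_product m_def power3_eq_cube)
    finally show ?thesis by (simp add: cardB)
  qed

  have "real (card T1) + 3 * real (card T2)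
      \<le> (p + m) ^ 3 - m ^ 3 + h + 3 * (p\<^sup>2 * m + 2 * p * e)"
    using T1 mult_left_mono[OF T2, of 3] by simp
  also have "\<dots> \<le> 5 / 3 * (p + m) ^ 3"
  proof (cases "m \<le> p")
    case True
    have "0 \<le> m\<^sup>2 - 2 * e" by (simp flip: cardNE)
    \<comment> \<open>Enlarging the factor \<open>m\<close> to \<open>p\<close> makes the term in
      \<open>e\<close> exactly \<open>-6 * p * e\<close>, which cancels the joined pairs counted in
      \<open>T2\<close>.\<close>
    then have "h \<le> 3 * p * (m\<^sup>2 - 2 * e)"
      using True nn hNE
      by (meson mult_le_cancel_left_pos mult_right_mono order_trans zero_less_numeral)
    \<comment> \<open>\<open>7/5\<close> approximates the optimal ratio \<open>p/m = sqrt 2\<close>\<close>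
    moreover have "0 \<le> (5 * p - 7 * m)\<^sup>2 * (4 * p + 5 * m)"
      using nn by (intro mult_nonneg_nonneg) auto
    moreover have "0 \<le> p\<^sup>2 * m" "0 \<le> p * m\<^sup>2" "0 \<le> m ^ 3" using nn by auto
    ultimately show ?thesis
      by (simp add: power2_eq_square power3_eq_cube algebra_simps)
  next
    case False
    then have pm: "p < m" by simp
    \<comment> \<open>The two bounds on \<open>h\<close> are averaged with weights
      \<open>m - p\<close> and \<open>p\<close>, chosen so that \<open>e\<close> cancels
      again.\<close>
    have "(m - p) * h \<le> (m - p) * m ^ 3"
      using pm hm by (intro mult_left_mono) auto
    moreover have "p * h \<le> p * (3 * m * (m\<^sup>2 - 2 * e))"
      using nn hNE by (intro mult_left_mono) auto
    ultimately have "m * h + 6 * p * e * m \<le> m * (3 * p * m\<^sup>2 + m\<^sup>2 * (m - p))"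
      by (simp add: power2_eq_square power3_eq_cube algebra_simps)
    then have "m * (h + 6 * p * e) \<le> m * (3 * p * m\<^sup>2 + m\<^sup>2 * (m - p))"
      by (simp add: algebra_simps)
    then have "h + 6 * p * e \<le> 3 * p * m\<^sup>2 + m\<^sup>2 * (m - p)"
      using pm nn by (simp add: mult_le_cancel_left_pos)
    moreover have "0 \<le> (p - m)\<^sup>2 * (2 * p + m)" "0 \<le> m ^ 3"
      using nn by auto
    ultimately show ?thesis
      by (simp add: power2_eq_square power3_eq_cube algebra_simps)
  qed
  finally show ?thesis by (simp add: T1_def T2_def cardB)
qed

section \<open>Winning tuples of distinct indices in a finite sample\<close>

definition distinct4 :: "'i set \<Rightarrow> ('i \<times> 'i \<times> 'i \<times> 'i) set" where
  "distinct4 A = {(i, j, k, l) \<in> A \<times> A \<times> A \<times> A. distinct [i, j, k, l]}"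

lemma finite_distinct4: "finite A \<Longrightarrow> finite (distinct4 A)"
  by (rule finite_subset[of _ "A \<times> A \<times> A \<times> A"]) (auto simp: distinct4_def)

lemma card_distinct4:
  assumes "finite A"
  shows "card (distinct4 A) = card A * ((card A - 1) * ((card A - 2) * (card A - 3)))"
proof -
  have "distinct4 A = (SIGMA i:A. SIGMA j:A - {i}. SIGMA k:A - {i, j}. A - {i, j, k})"
    by (auto simp: distinct4_def)
  also have "card \<dots> =
      (\<Sum>i\<in>A. \<Sum>j\<in>A - {i}. \<Sum>k\<in>A - {i, j}. card (A - {i, j, k}))"
    using assms by simp
  also have "\<dots> = (\<Sum>i\<in>A. \<Sum>j\<in>A - {i}. \<Sum>k\<in>A - {i, j}. card A - 3)"
    by (intro sum.cong refl) (auto simp: card_Diff_subset)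
  also have "\<dots> = (\<Sum>i\<in>A. \<Sum>j\<in>A - {i}. (card A - 2) * (card A - 3))"
    by (intro sum.cong refl) (auto simp: card_Diff_subset)
  also have "\<dots> = (\<Sum>i\<in>A. (card A - 1) * ((card A - 2) * (card A - 3)))"
    by (intro sum.cong refl) (auto simp: card_Diff_subset)
  finally show ?thesis by simp
qed

text \<open>Induction by removing a point of maximal value. The bound telescopes: passing from
  \<open>n\<close> to \<open>n + 1\<close> points raises it by
  \<open>5/12 * n^2 * ((n+1)^2 - (n-1)^2) = 5/3 * n^3\<close>, the bound for tuples through the
  maximum.\<close>

lemma card_winning_tuples:
  fixes x :: "'i \<Rightarrow> real"
  assumes "finite A" "\<And>i. i \<in> A \<Longrightarrow> 0 \<le> x i"
  shows "real (card {(i, j, k, l) \<in> distinct4 A. x i + x j + x k < 2 * x l})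
       \<le> 5 / 12 * (real (card A) * (real (card A) - 1))\<^sup>2"
  using assms
proof (induction A rule: finite_remove_induct)
  case empty
  then show ?case by (simp add: distinct4_def)
next
  case (remove A)
  have "Max (x ` A) \<in> x ` A" using remove.hyps by simp
  then obtain d where d: "d \<in> A" and "Max (x ` A) = x d" by auto
  with remove.hyps have le: "x i \<le> x d" if "i \<in> A" for i
    using that by (metis Max_ge finite_imageI imageI)
  define B where "B = A - {d}"
  let ?W = "\<lambda>A. {(i, j, k, l) \<in> distinct4 A. x i + x j + x k < 2 * x l}"
  let ?T1 = "{(a, b, c) \<in> B \<times> B \<times> B. x a + x b + x c < 2 * x d}"
  let ?T2 = "{(a, b, c) \<in> B \<times> B \<times> B. x a + x b + x d < 2 * x c}"
  let ?f1 = "\<lambda>(a, b, c). (a, b, c, d)" and ?f2 = "\<lambda>(a, b, c). (d, a, b, c)"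
  let ?f3 = "\<lambda>(a, b, c). (a, d, b, c)" and ?f4 = "\<lambda>(a, b, c). (a, b, d, c)"
  have finB: "finite B" using remove.hyps by (simp add: B_def)
  have fin: "finite (?W B)" "finite ?T1" "finite ?T2"
  proof -
    show "finite (?W B)"
      by (rule finite_subset[OF _ finite_distinct4[OF finB]]) auto
    show "finite ?T1" "finite ?T2"
      by (rule finite_subset[of _ "B \<times> B \<times> B"]; use finB in auto)+
  qed
  have "?W A \<subseteq> ?W B \<union> (?f1 ` ?T1 \<union> (?f2 ` ?T2 \<union> (?f3 ` ?T2 \<union> ?f4 ` ?T2)))"
  proof
    fix t assume t: "t \<in> ?W A"
    obtain i j k l where tt: "t = (i, j, k, l)" by (cases t)
    have A: "i \<in> A" "j \<in> A" "k \<in> A" "l \<in> A" "distinct [i, j, k, l]"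
      "x i + x j + x k < 2 * x l"
      using t by (auto simp: tt distinct4_def)
    consider "l = d" | "i = d" | "j = d" | "k = d" | "d \<notin> {i, j, k, l}" by auto
    then show "t \<in> ?W B \<union> (?f1 ` ?T1 \<union> (?f2 ` ?T2 \<union> (?f3 ` ?T2 \<union> ?f4 ` ?T2)))"
    proof cases
      case 1
      with A have "t \<in> ?f1 ` ?T1" by (auto simp: tt B_def image_iff)
      then show ?thesis by blast
    next
      case 2
      with A have "t \<in> ?f2 ` ?T2" by (auto simp: tt B_def image_iff)
      then show ?thesis by blast
    next
      case 3
      with A have "t \<in> ?f3 ` ?T2" by (auto simp: tt B_def image_iff)
      then show ?thesis by blast
    next
      case 4
      with A have "t \<in> ?f4 ` ?T2" by (auto simp: tt B_def image_iff)
      then show ?thesis by blast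
    next
      case 5
      with A have "t \<in> ?W B" by (auto simp: tt B_def distinct4_def)
      then show ?thesis by blast
    qed
  qed
  then have "card (?W A)
      \<le> card (?W B \<union> (?f1 ` ?T1 \<union> (?f2 ` ?T2 \<union> (?f3 ` ?T2 \<union> ?f4 ` ?T2))))"
    by (rule card_mono[rotated]) (use fin in blast)
  also have "\<dots> \<le> card (?W B) + (card (?f1 ` ?T1) + (card (?f2 ` ?T2)
      + (card (?f3 ` ?T2) + card (?f4 ` ?T2))))"
    by (intro order_trans[OF card_Un_le] add_left_mono card_Un_le)
  also have "\<dots> \<le> card (?W B) + (card ?T1 + (card ?T2 + (card ?T2 + card ?T2)))"
    by (intro add_mono card_image_le fin order_refl)
  finally have "real (card (?W A)) \<le> real (card (?W B)) + (real (card ?T1) + 3 * real (card ?T2))"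
    by linarith
  also have "real (card ?T1) + 3 * real (card ?T2) \<le> 5 / 3 * real (card B) ^ 3"
    by (rule card_triples_with_max_le) (use finB remove.prems le in \<open>auto simp: B_def\<close>)
  also have "real (card (?W B)) \<le> 5 / 12 * (real (card B) * (real (card B) - 1))\<^sup>2"
    unfolding B_def by (rule remove.IH) (use d remove.prems in auto)
  also have "real (card A) = real (card B) + 1"
    using d remove.hyps by (simp add: B_def card_gt_0_iff of_nat_diff Suc_leI)
  then have "5 / 12 * (real (card B) * (real (card B) - 1))\<^sup>2 + 5 / 3 * real (card B) ^ 3
      = 5 / 12 * (real (card A) * (real (card A) - 1))\<^sup>2"
    by (simp add: power2_eq_square power3_eq_cube algebra_simps)
  finally show ?case by simp
qed

section \<open>From counting to probability\<close>

text \<open>Selecting four distinct coordinates is an injective reindexing, so it pushes the sample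
  measure forward to \<open>product4 \<mu>\<close>.\<close>

lemma measure_sample_eq_event_prob:
  assumes mu: "\<mu> \<in> borel_prob_nonneg" and t: "(i, j, k, l) \<in> distinct4 I"
  shows "{X \<in> space (\<Pi>\<^sub>M i\<in>I. \<mu>). X i + X j + X k < 2 * X l} \<in> sets (\<Pi>\<^sub>M i\<in>I. \<mu>)"
    and "measure (\<Pi>\<^sub>M i\<in>I. \<mu>)
      {X \<in> space (\<Pi>\<^sub>M i\<in>I. \<mu>). X i + X j + X k < 2 * X l} = event_prob \<mu>"
proof -
  interpret prob_space \<mu> using mu by (simp add: borel_prob_nonneg_def)
  define f :: "nat \<Rightarrow> 'a" where
    "f n = (if n = 1 then i else if n = 2 then j else if n = 3 then k else l)" for n
  define g where "g = (\<lambda>X::'a \<Rightarrow> real. \<lambda>n\<in>{1..4::nat}. X (f n))"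
  have f_in: "f \<in> {1..4} \<rightarrow> I" using t by (auto simp: f_def distinct4_def)
  have "distr (\<Pi>\<^sub>M i\<in>I. \<mu>) (\<Pi>\<^sub>M n\<in>{1..4::nat}. \<mu>) g = (\<Pi>\<^sub>M n\<in>{1..4}. \<mu>)"
    unfolding g_def
  proof (rule distr_PiM_reindex[where M = "\<lambda>_. \<mu>"])
    have "{1..4::nat} = {1, 2, 3, 4}" by auto
    then show "inj_on f {1..4}" using t by (auto simp: f_def distinct4_def inj_on_def)
  qed (use f_in prob_space_axioms in auto)
  then have distr: "distr (\<Pi>\<^sub>M i\<in>I. \<mu>) (product4 \<mu>) g = product4 \<mu>"
    by (simp add: product4_def)
  have g: "g \<in> measurable (\<Pi>\<^sub>M i\<in>I. \<mu>) (product4 \<mu>)"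
    unfolding g_def product4_def
    by (intro measurable_restrict measurable_component_singleton) (use f_in in auto)
  have eq: "{X \<in> space (\<Pi>\<^sub>M i\<in>I. \<mu>). X i + X j + X k < 2 * X l}
      = g -` {X \<in> space (product4 \<mu>). X 1 + X 2 + X 3 < 2 * X 4} \<inter> space (\<Pi>\<^sub>M i\<in>I. \<mu>)"
    using measurable_space[OF g] by (auto simp: g_def f_def)
  show "{X \<in> space (\<Pi>\<^sub>M i\<in>I. \<mu>). X i + X j + X k < 2 * X l} \<in> sets (\<Pi>\<^sub>M i\<in>I. \<mu>)"
    unfolding eq using g event_measurable[OF mu] by (rule measurable_sets)
  show "measure (\<Pi>\<^sub>M i\<in>I. \<mu>)
      {X \<in> space (\<Pi>\<^sub>M i\<in>I. \<mu>). X i + X j + X k < 2 * X l} = event_prob \<mu>"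
    unfolding eq event_prob_def
    by (subst distr[symmetric], rule measure_distr[symmetric, OF g event_measurable[OF mu]])
qed

text \<open>By linearity the left side is the expected number of winning tuples in a sample of size
  \<open>N\<close>, and the counting bound holds for every outcome.\<close>

lemma event_prob_le_sample_bound:
  assumes mu: "\<mu> \<in> borel_prob_nonneg"
  shows "real (card (distinct4 {..<N})) * event_prob \<mu> \<le> 5 / 12 * (real N * (real N - 1))\<^sup>2"
proof -
  define M where "M = (\<Pi>\<^sub>M i\<in>{..<N}. \<mu>)"
  interpret M: prob_space M
    unfolding M_def using mu by (intro prob_space_PiM) (simp add: borel_prob_nonneg_def)
  define E where "E = (\<lambda>(i, j, k, l). {X \<in> space M. X i + X j + X k < 2 * X l})"
  let ?D = "distinct4 {..<N}"
  have fin: "finite ?D" by (simp add: finite_distinct4)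
  have E: "E t \<in> sets M" "measure M (E t) = event_prob \<mu>" if "t \<in> ?D" for t
    using that measure_sample_eq_event_prob[OF mu, of _ _ _ _ "{..<N}"]
    by (auto simp: E_def M_def split: prod.splits)
  have "real (card ?D) * event_prob \<mu> = (\<Sum>t\<in>?D. measure M (E t))"
    by (simp add: E)
  also have "\<dots> = (\<Sum>t\<in>?D. \<integral>X. indicator (E t) X \<partial>M)"
    using E by (intro sum.cong refl) (simp add: Int_absorb1 sets.sets_into_space)
  also have "\<dots> = (\<integral>X. (\<Sum>t\<in>?D. indicator (E t) X) \<partial>M)"
    using E by (intro Bochner_Integration.integral_sum[symmetric] M.integrable_const_bound[where B = 1]) auto
  also have "\<dots> \<le> (\<integral>X. 5 / 12 * (real N * (real N - 1))\<^sup>2 \<partial>M)"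
  proof (rule integral_mono)
    show "integrable M (\<lambda>X. \<Sum>t\<in>?D. indicator (E t) X :: real)"
      using E by (intro Bochner_Integration.integrable_sum M.integrable_const_bound[where B = 1]) auto
    fix X assume X: "X \<in> space M"
    have nonneg: "0 \<le> X i" if "i < N" for i
    proof -
      have "X i \<in> space \<mu>" using X that by (auto simp: M_def space_PiM)
      then show ?thesis by (simp add: space_borel_prob_nonneg[OF mu])
    qed
    have "(\<Sum>t\<in>?D. indicator (E t) X :: real) = real (card {t \<in> ?D. X \<in> E t})"
      using fin by (simp add: indicator_def sum.If_cases Int_def)
    also have "{t \<in> ?D. X \<in> E t} = {(i, j, k, l) \<in> ?D. X i + X j + X k < 2 * X l}"
      using X by (auto simp: E_def)
    also have "real (card \<dots>) \<le> 5 / 12 * (real (card {..<N}) * (real (card {..<N}) - 1))\<^sup>2"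
      by (rule card_winning_tuples) (use nonneg in auto)
    finally show "(\<Sum>t\<in>?D. indicator (E t) X) \<le> 5 / 12 * (real N * (real N - 1))\<^sup>2" by simp
  qed simp
  finally show ?thesis by (simp add: M.prob_space)
qed

lemma event_prob_le:
  assumes "\<mu> \<in> borel_prob_nonneg"
  shows "event_prob \<mu> \<le> 673 / 1615"
  \<comment> \<open>The sample bound is \<open>5/12 * N (N-1) / ((N-2) (N-3))\<close>, about
    \<open>5/12 * (1 + 4/N)\<close>. Since \<open>673/1615 - 5/12 = 1/19380\<close>, this
    \<open>N\<close> is ample.\<close>
  using event_prob_le_sample_bound[OF assms, of 100000] by (simp add: card_distinct4)

section \<open>Self-similar finitely supported measures\<close>

text \<open>Each variable has its own range, so that the weight of a mixture can be expanded block
  by block.\<close>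

definition box_weight :: "(real \<Rightarrow> real) \<Rightarrow> real set \<Rightarrow> real set \<Rightarrow> real set \<Rightarrow> real set \<Rightarrow> real" where
  "box_weight w A B C D =
     (\<Sum>a\<in>A. \<Sum>b\<in>B. \<Sum>c\<in>C. \<Sum>d\<in>D. w a * w b * w c * w d * of_bool (a + b + c < 2 * d))"

definition attained :: "real \<Rightarrow> bool" where
  "attained v \<longleftrightarrow> (\<exists>S w. finite S \<and> S \<subseteq> {0..} \<and> (\<forall>x. 0 \<le> w x) \<and> sum w S = 1 \<and> box_weight w S S S S = v)"

lemma attained_le_event_prob:
  assumes "attained v"
  shows "\<exists>\<mu>\<in>borel_prob_nonneg. v \<le> event_prob \<mu>"
proof -
  obtain S w where S: "finite S" "S \<subseteq> {0..}" and w: "\<And>x. 0 \<le> w x" "sum w S = 1"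
    and v: "box_weight w S S S S = v"
    using assms by (auto simp: attained_def)
  define R where "R = restrict_space (borel :: real measure) {0..}"
  define P where "P = point_measure S (\<lambda>x. ennreal (w x))"
  \<comment> \<open>The point measure carries the discrete sigma-algebra on \<open>S\<close>; the
    push-forward along the identity puts it on the Borel sets of the half-line.\<close>
  define \<mu> where "\<mu> = distr P R (\<lambda>x. x)"
  have [simp]: "sets \<mu> = sets R" by (simp add: \<mu>_def)
  have id: "(\<lambda>x. x) \<in> measurable P R"
    using S by (auto simp: P_def R_def space_restrict_space)
  have "prob_space P"
    using S w by (intro prob_spaceI)
      (simp add: P_def space_point_measure emeasure_point_measure_finite sum_ennreal)
  then have "prob_space \<mu>" unfolding \<mu>_def using id by (rule prob_space.prob_space_distr)
  then have mu: "\<mu> \<in> borel_prob_nonneg" by (simp add: borel_prob_nonneg_def R_def)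
  have sing: "{x} \<in> sets \<mu>" if "x \<in> S" for x
    using that S by (auto simp: R_def sets_restrict_space_iff)
  have msing: "measure \<mu> {x} = w x" if "x \<in> S" for x
  proof -
    have "emeasure \<mu> {x} = emeasure P ({x} \<inter> S)"
      using sing[OF that] id by (simp add: \<mu>_def emeasure_distr P_def space_point_measure)
    also have "\<dots> = ennreal (w x)"
      using that S by (simp add: P_def emeasure_point_measure_finite)
    finally show ?thesis using w by (simp add: measure_def)
  qed
  interpret mu: prob_space \<mu> by fact
  interpret finite_product_prob_space "\<lambda>_::nat. \<mu>" "{1..4}" by standard simp
  \<comment> \<open>Restricting to \<open>{1..4}\<close> makes \<open>tup t\<close> an extensional
    function, so that \<open>{tup t}\<close> is a box of singletons in the product space.\<close>
  define tup :: "real \<times> real \<times> real \<times> real \<Rightarrow> nat \<Rightarrow> real" where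
    "tup = (\<lambda>(a, b, c, d). \<lambda>i\<in>{1..4}. if i = 1 then a else if i = 2 then b else if i = 3 then c else d)"
  have I4: "{1..4::nat} = {1, 2, 3, 4}" by auto
  have inj: "inj tup"
  proof (rule injI)
    fix s t assume eq: "tup s = tup t"
    obtain a b c d where s: "s = (a, b, c, d)" by (cases s)
    obtain a' b' c' d' where t: "t = (a', b', c', d')" by (cases t)
    have "tup s i = tup t i" for i by (simp add: eq)
    from this[of 1] this[of 2] this[of 3] this[of 4] show "s = t"
      by (simp add: s t tup_def)
  qed
  have PiE: "Pi\<^sub>E {1..4} (\<lambda>i. {tup t i}) = {tup t}" for t
    by (rule PiE_singleton) (auto simp: tup_def split: prod.splits)
  have msing4: "{tup t} \<in> sets (product4 \<mu>)"
    "measure (product4 \<mu>) {tup t} = (case t of (a, b, c, d) \<Rightarrow> w a * w b * w c * w d)"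
    if "t \<in> S \<times> S \<times> S \<times> S" for t
  proof -
    obtain a b c d where t: "t = (a, b, c, d)" by (cases t)
    have tS: "tup t i \<in> S" if "i \<in> {1..4}" for i
      using that \<open>t \<in> S \<times> S \<times> S \<times> S\<close> by (auto simp: t tup_def)
    show "{tup t} \<in> sets (product4 \<mu>)"
      unfolding PiE[symmetric] product4_def using tS by (intro sets_PiM_I_finite sing) auto
    have "measure (product4 \<mu>) {tup t} = (\<Prod>i\<in>{1..4}. measure \<mu> {tup t i})"
      unfolding PiE[symmetric] product4_def using tS by (intro prob_times sing) auto
    also have "\<dots> = (\<Prod>i\<in>{1..4}. w (tup t i))"
      using tS by (intro prod.cong refl msing) auto
    also have "\<dots> = w a * w b * w c * w d"
      unfolding I4 by (simp add: t tup_def mult.assoc)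
    finally show "measure (product4 \<mu>) {tup t} = (case t of (a, b, c, d) \<Rightarrow> w a * w b * w c * w d)"
      by (simp add: t)
  qed
  interpret P4: prob_space "product4 \<mu>"
    unfolding product4_def by (rule prob_space_axioms)
  define G where "G = {(a, b, c, d) \<in> S \<times> S \<times> S \<times> S. a + b + c < 2 * d}"
  have GS: "G \<subseteq> S \<times> S \<times> S \<times> S" by (auto simp: G_def)
  have finG: "finite G" using GS by (rule finite_subset) (use S in auto)
  have "v = (\<Sum>t\<in>S \<times> S \<times> S \<times> S. case t of (a, b, c, d) \<Rightarrow>
      w a * w b * w c * w d * of_bool (a + b + c < 2 * d))"
    by (simp add: v[symmetric] box_weight_def sum.cartesian_product split_def)
  also have "\<dots> = (\<Sum>t\<in>G. case t of (a, b, c, d) \<Rightarrow> w a * w b * w c * w d)"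
    using S by (intro sum.mono_neutral_cong_right) (auto simp: G_def)
  also have "\<dots> = (\<Sum>t\<in>G. measure (product4 \<mu>) {tup t})"
    using GS msing4(2) by (intro sum.cong refl) auto
  also have "\<dots> = (\<Sum>X\<in>tup ` G. measure (product4 \<mu>) {X})"
    using inj by (subst sum.reindex) (auto intro: inj_on_subset)
  also have "\<dots> = measure (product4 \<mu>) (tup ` G)"
    using finG GS msing4(1)
    by (intro P4.finite_measure_eq_sum_singleton[symmetric]) auto
  also have "\<dots> \<le> event_prob \<mu>"
    unfolding event_prob_def
  proof (rule P4.finite_measure_mono[OF _ event_measurable[OF mu]])
    have "tup t \<in> space (product4 \<mu>)" if "t \<in> G" for t
      using msing4(1)[of t] that GS sets.sets_into_space by blast
    then show "tup ` G \<subseteq> {X \<in> space (product4 \<mu>). X 1 + X 2 + X 3 < 2 * X 4}"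
      by (auto simp: G_def tup_def)
  qed
  finally show ?thesis using mu by blast
qed

section \<open>Block decomposition of event weights\<close>

lemma box_weight_nonneg: "(\<And>x. 0 \<le> w x) \<Longrightarrow> 0 \<le> box_weight w A B C D"
  unfolding box_weight_def by (intro sum_nonneg mult_nonneg_nonneg) auto

lemma box_weight_swap12: "box_weight w A B C D = box_weight w B A C D"
  unfolding box_weight_def by (subst sum.swap) (simp add: ac_simps)

lemma box_weight_swap23: "box_weight w A B C D = box_weight w A C B D"
proof -
  have "(\<Sum>b\<in>B. \<Sum>c\<in>C. \<Sum>d\<in>D. w a * w b * w c * w d * of_bool (a + b + c < 2 * d))
      = (\<Sum>c\<in>C. \<Sum>b\<in>B. \<Sum>d\<in>D. w a * w c * w b * w d * of_bool (a + c + b < 2 * d))" for a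
    by (subst sum.swap) (simp add: ac_simps)
  then show ?thesis unfolding box_weight_def by simp
qed

lemma box_weight_Un:
  assumes "finite L" "finite T" "L \<inter> T = {}"
  shows "box_weight w (L \<union> T) B C D = box_weight w L B C D + box_weight w T B C D"
    and "box_weight w A (L \<union> T) C D = box_weight w A L C D + box_weight w A T C D"
    and "box_weight w A B (L \<union> T) D = box_weight w A B L D + box_weight w A B T D"
    and "box_weight w A B C (L \<union> T) = box_weight w A B C L + box_weight w A B C T"
  unfolding box_weight_def
  by (simp_all add: sum.union_disjoint[OF assms] sum.distrib)

text \<open>Of the 16 blocks, eight are kept and grouped by the symmetry of the first three
  variables. The others are the seven with \<open>X 4\<close> alone or outweighed in
  \<open>L\<close> against some point of \<open>T\<close>, and the all-\<open>T\<close> block; in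
  the construction below they all vanish, so nothing is lost.\<close>

lemma box_weight_Un_ge:
  assumes "finite L" "finite T" "L \<inter> T = {}" "\<And>x. 0 \<le> w x"
  shows "box_weight w L L L L + box_weight w L L L T + 3 * box_weight w T L L T
      + 3 * box_weight w T T L T \<le> box_weight w (L \<union> T) (L \<union> T) (L \<union> T) (L \<union> T)"
proof -
  note nn = box_weight_nonneg[of w, OF assms(4)]
  have s: "box_weight w L T L T = box_weight w T L L T"
    "box_weight w L L T T = box_weight w T L L T"
    "box_weight w T L T T = box_weight w T T L T"
    "box_weight w L T T T = box_weight w T T L T"
    by (metis box_weight_swap12 box_weight_swap23)+
  show ?thesis
    unfolding box_weight_Un[OF assms(1-3)] s
    using nn[of L L T L] nn[of L T L L] nn[of L T T L] nn[of T L L L] nn[of T L T L]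
      nn[of T T L L] nn[of T T T L] nn[of T T T T]
    by linarith
qed

lemma box_weight_eq_prod:
  assumes "\<And>a b c d. a \<in> A \<Longrightarrow> b \<in> B \<Longrightarrow> c \<in> C \<Longrightarrow> d \<in> D \<Longrightarrow> a + b + c < 2 * d"
  shows "box_weight w A B C D = sum w A * sum w B * sum w C * sum w D"
proof -
  have "box_weight w A B C D = (\<Sum>a\<in>A. \<Sum>b\<in>B. \<Sum>c\<in>C. \<Sum>d\<in>D. w a * w b * w c * w d)"
    unfolding box_weight_def using assms by (intro sum.cong refl) simp
  also have "\<dots> = sum w A * sum w B * sum w C * sum w D"
    by (simp add: mult.assoc flip: sum_distrib_left sum_distrib_right)
  finally show ?thesis .
qed

section \<open>Mixing a tiny copy with points accumulating at 1\<close>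

text \<open>For fixed \<open>l\<close> the condition fails exactly on the \<open>(K - l)^2\<close>
  pairs with both indices at least \<open>l\<close>; summing squares gives the subtracted term. The
  proportion of good triples tends to \<open>2/3\<close>.\<close>

lemma sum_not_min:
  "6 * (\<Sum>i<K. \<Sum>j<K. \<Sum>l<K. of_bool (i < l \<or> j < l) :: real)
     = 6 * real K ^ 3 - real K * (real K + 1) * (2 * real K + 1)"
proof -
  have *: "(\<Sum>i<K. \<Sum>j<K. of_bool (i < l \<or> j < l)) = (real K)\<^sup>2 - (real K - real l)\<^sup>2"
    if "l \<le> K" for l
  proof -
    have "(\<Sum>i<K. of_bool (l \<le> i) :: real) = real (card {l..<K})"
      by (simp add: of_bool_def sum.If_cases Int_def atLeastLessThan_def lessThan_def atLeast_def conj_commute)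
    then have c: "(\<Sum>i<K. of_bool (l \<le> i) :: real) = real K - real l" using that by (simp add: of_nat_diff)
    have "(\<Sum>i<K. \<Sum>j<K. of_bool (i < l \<or> j < l) :: real)
        = (\<Sum>i<K. \<Sum>j<K. 1 - of_bool (l \<le> i) * of_bool (l \<le> j))"
      by (intro sum.cong refl) auto
    also have "\<dots> = (real K)\<^sup>2 - (\<Sum>i<K. of_bool (l \<le> i)) * (\<Sum>j<K. of_bool (l \<le> j))"
      unfolding sum_product by (simp add: sum_subtractf power2_eq_square del: sum_of_bool_mult_eq)
    finally show ?thesis by (simp only: c power2_eq_square)
  qed
  have sq: "6 * (\<Sum>l<n. (real n - real l)\<^sup>2) = real n * (real n + 1) * (2 * real n + 1)" for n
  proof (induction n)
    case (Suc n)
    have "(\<Sum>l<Suc n. (real (Suc n) - real l)\<^sup>2) = (real n + 1)\<^sup>2 + (\<Sum>l<n. (real n - real l)\<^sup>2)"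
      by (subst sum.lessThan_Suc_shift) simp
    then show ?case using Suc.IH by (simp add: power2_eq_square algebra_simps)
  qed simp
  have "(\<Sum>i<K. \<Sum>j<K. \<Sum>l<K. of_bool (i < l \<or> j < l) :: real)
      = (\<Sum>i<K. \<Sum>l<K. \<Sum>j<K. of_bool (i < l \<or> j < l))"
    by (intro sum.cong refl sum.swap)
  also have "\<dots> = (\<Sum>l<K. \<Sum>i<K. \<Sum>j<K. of_bool (i < l \<or> j < l))"
    by (rule sum.swap)
  also have "\<dots> = (\<Sum>l<K. (real K)\<^sup>2 - (real K - real l)\<^sup>2)"
    by (intro sum.cong refl *) auto
  finally show ?thesis
    using sq[of K] by (simp add: sum_subtractf right_diff_distrib power2_eq_square power3_eq_cube)
qed

text \<open>\<open>L\<close> is a scaled copy of the given support with total weight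
  \<open>p\<close>, and \<open>T\<close> carries \<open>1 - p\<close> uniformly on \<open>K\<close>
  points. The four summands come from the blocks \<open>LLLL\<close>, \<open>LLLT\<close>,
  \<open>TLLT\<close> and \<open>TTLT\<close>; scale invariance of the event yields
  \<open>p ^ 4 * v\<close>.\<close>

lemma attained_step:
  fixes p v :: real and K :: nat
  assumes v: "attained v" and p: "0 < p" "p < 1" and K: "0 < K"
  shows "\<exists>v'. attained v' \<and> p ^ 4 * v + (1 - p) * p ^ 3 + 3 * (1 - p)\<^sup>2 * p\<^sup>2
      + 3 * (1 - p) ^ 3 * p * (1 - (real K + 1) * (2 * real K + 1) / (6 * (real K)\<^sup>2)) \<le> v'"
proof -
  obtain S w where S: "finite S" "S \<subseteq> {0..}" and w: "\<And>x. 0 \<le> w x" "sum w S = 1"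
    and v: "box_weight w S S S S = v"
    using assms(1) by (auto simp: attained_def)
  define \<delta> where "\<delta> = (1 / 4 :: real) ^ K"
  \<comment> \<open>Every point of \<open>S\<close> is at most \<open>\<Sum>S\<close>, so the scaled
    points lie below \<open>\<delta>\<close>; the added 1 keeps the denominator positive when
    \<open>S\<close> is \<open>{0}\<close>.\<close>
  define \<epsilon> where "\<epsilon> = \<delta> / (1 + \<Sum>S)"
  define t where "t y = 1 - (1 / 4 :: real) ^ Suc y" for y
  define L where "L = (\<lambda>x. \<epsilon> * x) ` S"
  define T where "T = t ` {..<K}"
  \<comment> \<open>The threshold \<open>1/2\<close> separates \<open>L\<close>, below
    \<open>1/4\<close>, from \<open>T\<close>, at least \<open>3/4\<close>.\<close>
  define w' where "w' x = (if x < 1 / 2 then p * w (x / \<epsilon>) else (1 - p) / real K)" for x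
  have \<delta>: "0 < \<delta>" "\<delta> \<le> 1 / 4"
    using K power_decreasing[of 1 K "1 / 4 :: real"] by (auto simp: \<delta>_def)
  have S0: "0 \<le> \<Sum>S" using S by (intro sum_nonneg) auto
  then have \<epsilon>: "0 < \<epsilon>" using \<delta> by (simp add: \<epsilon>_def)
  have L: "0 \<le> c" "c < \<delta>" if "c \<in> L" for c
  proof -
    obtain x where x: "x \<in> S" "c = \<epsilon> * x" using \<open>c \<in> L\<close> by (auto simp: L_def)
    have "x \<le> \<Sum>S" using x S by (intro member_le_sum) auto
    then have "\<delta> * x < \<delta> * (1 + \<Sum>S)" using \<delta> by simp
    then show "c < \<delta>" using S0 by (simp add: x \<epsilon>_def field_simps)
    show "0 \<le> c" using x S \<epsilon> by auto
  qed
  have t: "3 / 4 \<le> t y" "t y < 1" for y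
    using power_decreasing[of 0 y "1 / 4 :: real"] by (auto simp: t_def)
  have T: "3 / 4 \<le> a" "a < 1" if "a \<in> T" for a using that t by (auto simp: T_def)
  have inj_t: "inj t" by (auto simp: inj_def t_def power_inject_exp')
  have fin: "finite L" "finite T" using S by (auto simp: L_def T_def)
  have disj: "L \<inter> T = {}" using L T \<delta> by force
  have w'0: "0 \<le> w' x" for x using w p by (simp add: w'_def)
  have w'L: "w' (\<epsilon> * x) = p * w x" if "x \<in> S" for x
    using L[of "\<epsilon> * x"] that \<epsilon> \<delta> by (auto simp: w'_def L_def)
  have w't: "w' (t y) = (1 - p) / real K" for y using t[of y] by (simp add: w'_def)
  have inj_e: "inj_on (\<lambda>x. \<epsilon> * x) S" using \<epsilon> by (auto simp: inj_on_def)
  have sumL: "sum w' L = p"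
    unfolding L_def using inj_e w by (simp add: sum.reindex w'L flip: sum_distrib_left)
  have sumT: "sum w' T = 1 - p"
    unfolding T_def using inj_t K by (simp add: sum.reindex inj_on_subset w't)
  have LLLL: "box_weight w' L L L L = p ^ 4 * v"
  proof -
    have ev: "\<epsilon> * a + \<epsilon> * b + \<epsilon> * c < 2 * (\<epsilon> * d) \<longleftrightarrow> a + b + c < 2 * d" for a b c d
    proof -
      have "\<epsilon> * a + \<epsilon> * b + \<epsilon> * c < 2 * (\<epsilon> * d) \<longleftrightarrow> \<epsilon> * (a + b + c) < \<epsilon> * (2 * d)"
        by (simp add: algebra_simps)
      then show ?thesis using \<epsilon> by simp
    qed
    have "box_weight w' L L L L = (\<Sum>a\<in>S. \<Sum>b\<in>S. \<Sum>c\<in>S. \<Sum>d\<in>S.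
        p ^ 4 * (w a * w b * w c * w d * of_bool (a + b + c < 2 * d)))"
      unfolding box_weight_def L_def sum.reindex[OF inj_e] o_def
      by (intro sum.cong refl) (simp only: ev w'L, simp add: power4_eq_xxxx)
    also have "\<dots> = p ^ 4 * v"
      by (simp add: v[symmetric] box_weight_def sum_distrib_left)
    finally show ?thesis .
  qed
  have LLLT: "box_weight w' L L L T = (1 - p) * p ^ 3"
  proof -
    have "box_weight w' L L L T = sum w' L * sum w' L * sum w' L * sum w' T"
    proof (rule box_weight_eq_prod)
      fix a b c d assume "a \<in> L" "b \<in> L" "c \<in> L" "d \<in> T"
      then show "a + b + c < 2 * d" using L(2)[of a] L(2)[of b] L(2)[of c] T(1)[of d] \<delta> by simp
    qed
    then show ?thesis by (simp add: sumL sumT power3_eq_cube)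
  qed
  have TLLT: "box_weight w' T L L T = (1 - p)\<^sup>2 * p\<^sup>2"
  proof -
    have "box_weight w' T L L T = sum w' T * sum w' L * sum w' L * sum w' T"
    proof (rule box_weight_eq_prod)
      fix a b c d assume "a \<in> T" "b \<in> L" "c \<in> L" "d \<in> T"
      then show "a + b + c < 2 * d" using L(2)[of b] L(2)[of c] T[of a] T[of d] \<delta> by simp
    qed
    then show ?thesis by (simp add: sumL sumT power2_eq_square)
  qed
  \<comment> \<open>With \<open>u y = 1 - t y\<close> the claim reads
    \<open>2 * u l + c < u i + u j\<close>; it holds because \<open>c < \<delta> \<le> u l\<close>
    and \<open>4 * u l \<le> u i\<close>. The larger index wins whatever \<open>j\<close>
    is.\<close>
  have key: "t i + t j + c < 2 * t l" if "i < l" "l < K" "c < \<delta>" for i j l c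
  proof -
    define u where "u y = (1 / 4 :: real) ^ Suc y" for y
    have "4 * u l \<le> u i"
      using that power_decreasing[of "Suc i" l "1 / 4 :: real"] by (simp add: u_def)
    moreover have "\<delta> \<le> u l"
      unfolding \<delta>_def u_def using that by (intro power_decreasing) auto
    moreover have "0 < u j" "0 < u l" by (simp_all add: u_def)
    moreover have "t y = 1 - u y" for y by (simp add: t_def u_def)
    ultimately show ?thesis using that(3) by simp
  qed
  let ?c = "(\<Sum>i<K. \<Sum>j<K. \<Sum>l<K. of_bool (i < l \<or> j < l) :: real)"
  have TTLT: "(1 - p) ^ 3 * p * (1 - (real K + 1) * (2 * real K + 1) / (6 * (real K)\<^sup>2))
      \<le> box_weight w' T T L T"
  proof -
    have "((1 - p) / real K) ^ 3 * p * ?c = (\<Sum>i<K. \<Sum>j<K. \<Sum>c\<in>L. \<Sum>l<K.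
        ((1 - p) / real K) ^ 3 * w' c * of_bool (i < l \<or> j < l))"
    proof -
      have "(\<Sum>c\<in>L. \<Sum>l<K. ((1 - p) / real K) ^ 3 * w' c * of_bool (i < l \<or> j < l))
          = ((1 - p) / real K) ^ 3 * p * (\<Sum>l<K. of_bool (i < l \<or> j < l))" for i j
        by (simp add: sumL flip: sum_distrib_left sum_distrib_right)
      then show ?thesis by (simp add: sum_distrib_left)
    qed
    also have "\<dots> \<le> (\<Sum>i<K. \<Sum>j<K. \<Sum>c\<in>L. \<Sum>l<K.
        w' (t i) * w' (t j) * w' c * w' (t l) * of_bool (t i + t j + c < 2 * t l))"
    proof (intro sum_mono)
      fix i j c l assume *: "i \<in> {..<K}" "j \<in> {..<K}" "c \<in> L" "l \<in> {..<K}"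
      have "t i + t j + c < 2 * t l" if "i < l \<or> j < l"
        using that key[of i l c j] key[of j l c i] * L(2) by (auto simp: add_ac)
      then have "of_bool (i < l \<or> j < l) \<le> (of_bool (t i + t j + c < 2 * t l) :: real)"
        by auto
      then have "((1 - p) / real K) ^ 3 * w' c * of_bool (i < l \<or> j < l)
          \<le> ((1 - p) / real K) ^ 3 * w' c * of_bool (t i + t j + c < 2 * t l)"
        using p w'0 by (intro mult_left_mono) auto
      then show "((1 - p) / real K) ^ 3 * w' c * of_bool (i < l \<or> j < l)
          \<le> w' (t i) * w' (t j) * w' c * w' (t l) * of_bool (t i + t j + c < 2 * t l)"
        by (simp add: w't power3_eq_cube mult_ac)
    qed
    also have "\<dots> = box_weight w' T T L T"
      by (simp only: box_weight_def T_def sum.reindex[OF inj_on_subset[OF inj_t subset_UNIV]] o_def)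
    finally have le: "((1 - p) / real K) ^ 3 * p * ?c \<le> box_weight w' T T L T" .
    define \<beta> where "\<beta> = 1 - (real K + 1) * (2 * real K + 1) / (6 * (real K)\<^sup>2)"
    have "6 * (real K ^ 3 * \<beta>) = 6 * real K ^ 3 - real K * (real K + 1) * (2 * real K + 1)"
      using K by (simp add: \<beta>_def field_simps power2_eq_square power3_eq_cube)
    then have "6 * ?c = 6 * (real K ^ 3 * \<beta>)" by (simp only: sum_not_min)
    then have c: "?c = real K ^ 3 * \<beta>" by (rule mult_left_cancel[THEN iffD1, rotated]) simp
    have "((1 - p) / real K) ^ 3 * p * ?c = (1 - p) ^ 3 * p * \<beta>"
      unfolding c using K by (simp add: power_divide)
    with le show ?thesis by (simp only: \<beta>_def)
  qed
  have "attained (box_weight w' (L \<union> T) (L \<union> T) (L \<union> T) (L \<union> T))"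
    unfolding attained_def
  proof (intro exI conjI allI)
    show "L \<union> T \<subseteq> {0..}" using L T by force
    show "sum w' (L \<union> T) = 1" by (simp add: sum.union_disjoint fin disj sumL sumT)
  qed (use fin w'0 in auto)
  moreover note box_weight_Un_ge[OF fin disj, of w', OF w'0] LLLL LLLT TLLT
    mult_left_mono[OF TTLT, of 3]
  ultimately show ?thesis
    by (intro exI[of _ "box_weight w' (L \<union> T) (L \<union> T) (L \<union> T) (L \<union> T)"])
      (auto simp: mult.assoc)
qed

section \<open>Passing to the supremum\<close>

lemma attained_0: "attained 0"
  unfolding attained_def box_weight_def
  by (intro exI[of _ "{0}"] exI[of _ "\<lambda>_. 1"]) auto

text \<open>The supremum \<open>s\<close> of the attained values satisfies
  \<open>p ^ 4 * s + ?R \<le> s\<close>, which replaces an explicit iteration of the mixing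
  step.\<close>

lemma SUP_event_prob_ge:
  fixes p :: real and K :: nat
  assumes p: "0 < p" "p < 1" and K: "0 < K"
  shows "((1 - p) * p ^ 3 + 3 * (1 - p)\<^sup>2 * p\<^sup>2
      + 3 * (1 - p) ^ 3 * p * (1 - (real K + 1) * (2 * real K + 1) / (6 * (real K)\<^sup>2)))
      / (1 - p ^ 4) \<le> (SUP \<mu>\<in>borel_prob_nonneg. event_prob \<mu>)"
    (is "?R / _ \<le> ?sup")
proof -
  define s where "s = Sup (Collect attained)"
  have le: "v \<le> ?sup" if att: "attained v" for v
  proof -
    obtain \<mu> where "\<mu> \<in> borel_prob_nonneg" "v \<le> event_prob \<mu>"
      using attained_le_event_prob[OF att] by blast
    then show ?thesis using cSUP_upper[OF _ bdd_above_event_prob] by fastforce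
  qed
  have bdd: "bdd_above (Collect attained)" using le by (intro bdd_aboveI[of _ ?sup]) auto
  have ne: "Collect attained \<noteq> {}" using attained_0 by auto
  have p4: "0 < p ^ 4" "p ^ 4 < 1" using p by (auto simp: power_less_one_iff)
  have "v \<le> (s - ?R) / p ^ 4" if att: "attained v" for v
  proof -
    obtain v' where "attained v'" "p ^ 4 * v + ?R \<le> v'"
      using attained_step[OF att p K] by (auto simp: add_ac)
    moreover have "v' \<le> s" unfolding s_def using \<open>attained v'\<close> bdd by (intro cSup_upper) auto
    ultimately show ?thesis using p4 by (simp add: field_simps)
  qed
  then have "s \<le> (s - ?R) / p ^ 4"
    unfolding s_def by (intro cSup_least[OF ne]) auto
  then have "?R / (1 - p ^ 4) \<le> s" using p4 by (simp add: field_simps)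
  also have "s \<le> ?sup" unfolding s_def using le by (intro cSup_least[OF ne]) auto
  finally show ?thesis .
qed

theorem mainTheorem1:
  "0.400695 \<le> (SUP \<mu>\<in>borel_prob_nonneg. event_prob \<mu>) \<and>
   (SUP \<mu>\<in>borel_prob_nonneg. event_prob \<mu>) \<le> 673 / 1615 \<and>
   (673 / 1615 :: real) \<le> 0.417"
proof (intro conjI)
  show "0.400695 \<le> (SUP \<mu>\<in>borel_prob_nonneg. event_prob \<mu>)"
    \<comment> \<open>At this \<open>p\<close> the limiting value exceeds the target by about
      \<open>3.7e-7\<close>, while finite \<open>K\<close> costs roughly
      \<open>0.11 / K\<close>.\<close>
    by (rule order_trans[OF _ SUP_event_prob_ge[of "4743 / 10000" "10 ^ 7"]])
      (simp_all add: power_divide)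
  show "(SUP \<mu>\<in>borel_prob_nonneg. event_prob \<mu>) \<le> 673 / 1615"
    by (rule cSUP_least[OF borel_prob_nonneg_nonempty event_prob_le])
qed simp

end
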